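(* Let $s \ge 2$ and $n \ge 1$ be integers, and let $\mathcal{F}_1, \ldots, \mathcal{F}_s$ be a cross saturated sequence of families of subsets of $[n]$. Then $|\mathcal{F}_1| + \cdots + |\mathcal{F}_s| \ge (s-1)\,2^n$.
   Context: $[n] = \{1,\ldots,n\}$. A sequence of $s$ families $\mathcal{F}_1, \ldots, \mathcal{F}_s$ of subsets of $[n]$ is called cross dependant if there is no choice of sets $A_i \in \mathcal{F}_i$ for $i \in [s]$ such that $A_1, \ldots, A_s$ are pairwise disjoint. The sequence is called cross saturated if it is cross dependant and is maximal with respect to this property, i.e. for every $i \in [s]$ and every subset $A \subseteq [n]$ with $A \notin \mathcal{F}_i$, the sequence obtained by replacing $\mathcal{F}_i$ with $\mathcal{F}_i \cup \{A\}$ is not cross dependant. *)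

theory Defs
  imports Main "HOL-Library.Disjoint_Sets"
begin

text \<open>
  A sequence of families \<open>F\<^sub>1, \<dots>, F\<^sub>s\<close> of subsets of \<open>[n]\<close> is a function \<open>F\<close> on \<open>nat\<close> of which
  only the values at \<open>1, \<dots>, s\<close> matter. Disjointness of the chosen sets is indexed
  (\<open>A i \<inter> A j = {}\<close> whenever \<open>i \<noteq> j\<close>), so the empty set may be chosen from several families.
\<close>

definition cross_dependant :: "nat \<Rightarrow> (nat \<Rightarrow> nat set set) \<Rightarrow> bool" where
  "cross_dependant s F \<longleftrightarrow>
     \<not> (\<exists>A. (\<forall>i\<in>{1..s}. A i \<in> F i) \<and> disjoint_family_on A {1..s})"

definition cross_saturated :: "nat \<Rightarrow> nat \<Rightarrow> (nat \<Rightarrow> nat set set) \<Rightarrow> bool" where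
  "cross_saturated n s F \<longleftrightarrow>
     cross_dependant s F \<and>
     (\<forall>i\<in>{1..s}. \<forall>A. A \<subseteq> {1..n} \<and> A \<notin> F i \<longrightarrow> \<not> cross_dependant s (F(i := F i \<union> {A})))"

end

theory Submission
  imports Defs
begin

text \<open>
  Saturation makes every \<open>F\<^sub>i\<close> an up-set whose non-members are exactly the complements of the sets
  containing pairwise disjoint members of all the other families. So it suffices to bound the sum
  of the sizes of these ``boxes'' by \<open>2\<^sup>n\<close>. This goes by induction on the number of families. By
  the correlation inequality \<open>|P \<box> Q| \<le> |{X \<in> P. V - X \<in> Q}|\<close> for up-sets, two families \<open>F\<^sub>p\<close>, \<open>F\<^sub>q\<close>
  can be merged into the largest family that is cross dependant with the remaining ones: the two
  boxes omitting \<open>p\<close> and \<open>q\<close> together are no larger than the box \<open>H\<close> of the remaining families.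
\<close>

section \<open>Up-sets, boxes and their decomposition\<close>

definition upset_on :: "'a set \<Rightarrow> 'a set set \<Rightarrow> bool" where
  "upset_on V P \<longleftrightarrow> (\<forall>A\<in>P. \<forall>B. A \<subseteq> B \<longrightarrow> B \<subseteq> V \<longrightarrow> B \<in> P)"

definition box :: "'a set \<Rightarrow> 'i set \<Rightarrow> ('i \<Rightarrow> 'a set set) \<Rightarrow> 'a set set" where
  "box V I F = {X. X \<subseteq> V \<and> (\<exists>A. (\<forall>i\<in>I. A i \<in> F i \<and> A i \<subseteq> X) \<and> disjoint_family_on A I)}"

lemma upset_onD: "upset_on V P \<Longrightarrow> A \<in> P \<Longrightarrow> A \<subseteq> B \<Longrightarrow> B \<subseteq> V \<Longrightarrow> B \<in> P"
  unfolding upset_on_def by blast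

lemma boxI:
  assumes "X \<subseteq> V" "\<And>i. i \<in> I \<Longrightarrow> A i \<in> F i" "\<And>i. i \<in> I \<Longrightarrow> A i \<subseteq> X" "disjoint_family_on A I"
  shows "X \<in> box V I F"
  using assms unfolding box_def by blast

lemma boxE:
  assumes "X \<in> box V I F"
  obtains A where "X \<subseteq> V" "\<forall>i\<in>I. A i \<in> F i \<and> A i \<subseteq> X" "disjoint_family_on A I"
  using assms unfolding box_def by blast

lemma box_subset_Pow: "box V I F \<subseteq> Pow V"
  unfolding box_def by blast

lemma finite_box: "finite V \<Longrightarrow> finite (box V I F)"
  by (meson box_subset_Pow finite_Pow_iff finite_subset)

lemma upset_on_box: "upset_on V (box V I F)"
  unfolding upset_on_def box_def by (fastforce intro: order_trans)

lemma box_antimono: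
  assumes "J \<subseteq> I"
  shows "box V I F \<subseteq> box V J F"
proof
  fix X assume "X \<in> box V I F"
  then obtain A where "X \<subseteq> V" "\<forall>i\<in>I. A i \<in> F i \<and> A i \<subseteq> X" "disjoint_family_on A I"
    by (elim boxE)
  then show "X \<in> box V J F"
    using assms disjoint_family_on_mono[OF assms] by (intro boxI[where A = A]) blast+
qed

lemma box_cong: "(\<And>i. i \<in> I \<Longrightarrow> F i = G i) \<Longrightarrow> box V I F = box V I G"
  unfolding box_def by auto

lemma disjoint_family_on_fun_upd:
  assumes "disjoint_family_on A J" "\<And>i. i \<in> J \<Longrightarrow> i \<noteq> q \<Longrightarrow> A i \<inter> T = {}"
  shows "disjoint_family_on (A(q := T)) (insert q J)"
  using assms unfolding disjoint_family_on_def by (auto simp: Int_commute)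

lemma box_insertI:
  assumes "S \<in> box V J F" "T \<in> F q" "S \<inter> T = {}" "S \<union> T \<subseteq> X" "X \<subseteq> V"
  shows "X \<in> box V (insert q J) F"
proof -
  obtain A where A: "\<forall>i\<in>J. A i \<in> F i \<and> A i \<subseteq> S" "disjoint_family_on A J"
    using assms(1) by (elim boxE)
  show ?thesis
  proof (rule boxI[where A = "A(q := T)"])
    show "disjoint_family_on (A(q := T)) (insert q J)"
      using A assms(3) by (intro disjoint_family_on_fun_upd) blast+
  next
    fix i assume "i \<in> insert q J"
    then have "i = q \<or> i \<noteq> q \<and> A i \<in> F i \<and> A i \<subseteq> S"
      using A(1) by blast
    then show "(A(q := T)) i \<in> F i" "(A(q := T)) i \<subseteq> X"
      using assms(2,4) by auto
  qed (rule assms(5))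
qed

text \<open>The union of the sets chosen for \<open>J\<close> serves as \<open>S\<close>. This turns
  a box over many families into a disjoint occurrence of just two, \<open>box V J F\<close> and
  \<open>F q\<close>.\<close>

lemma box_insertE:
  assumes "X \<in> box V (insert q J) F" "q \<notin> J"
  obtains S T where "S \<in> box V J F" "T \<in> F q" "S \<inter> T = {}" "S \<union> T \<subseteq> X" "X \<subseteq> V"
proof -
  obtain A where A: "X \<subseteq> V" "\<forall>i\<in>insert q J. A i \<in> F i \<and> A i \<subseteq> X"
    "disjoint_family_on A (insert q J)"
    using assms(1) by (elim boxE)
  have "A i \<inter> A q = {}" if "i \<in> J" for i
    using A(3) assms(2) that by (intro disjoint_family_onD[of A "insert q J"]) auto
  then have dis: "(\<Union>i\<in>J. A i) \<inter> A q = {}"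
    by blast
  have "disjoint_family_on A J"
    using A(3) unfolding disjoint_family_on_def by blast
  then have "(\<Union>i\<in>J. A i) \<in> box V J F"
    using A by (intro boxI[where A = A]) blast+
  then show ?thesis
    using that[of "\<Union>i\<in>J. A i" "A q"] A dis by blast
qed

section \<open>A correlation inequality for disjoint occurrence\<close>

text \<open>Coordinates are switched one at a time from \<open>X\<close> to its complement as the
  home of \<open>T\<close>. An injection shows that no switch lowers the count.\<close>

lemma card_disjoint_occurrence_le:
  assumes V: "finite V" and P: "P \<subseteq> Pow V" "upset_on V P" and Q: "Q \<subseteq> Pow V" "upset_on V Q"
  shows "card {X. X \<subseteq> V \<and> (\<exists>S\<in>P. \<exists>T\<in>Q. S \<inter> T = {} \<and> S \<union> T \<subseteq> X)} \<le> card {X \<in> P. V - X \<in> Q}"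
proof -
  \<comment> \<open>Interpolate: on the coordinates in \<open>K\<close>, the \<open>Q\<close>-witness lives in the complement of \<open>X\<close>.\<close>
  define W where "W K S T X \<longleftrightarrow> S \<in> P \<and> T \<in> Q \<and> S \<inter> T = {} \<and> S \<subseteq> X \<and> T - K \<subseteq> X \<and> T \<inter> K \<inter> X = {}"
    for K S T X
  define E where "E K = {X. X \<subseteq> V \<and> (\<exists>S T. W K S T X)}" for K
  have fin: "finite (E K)" for K
    unfolding E_def using V by simp
  have step: "card (E K) \<le> card (E (insert k K))" if k: "k \<in> V" "k \<notin> K" for k K
  proof -
    \<comment> \<open>Here \<open>k\<close> lies in neither witness, since \<open>S\<close> and
      \<open>T - K\<close> are inside \<open>X\<close>; so adding \<open>k\<close> to
      \<open>X\<close> does no harm.\<close>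
    have up: "X \<in> E (insert k K) \<and> insert k X \<in> E (insert k K)"
      if "X \<in> E K" "k \<notin> X" for X
    proof -
      from that obtain S T where "X \<subseteq> V" and W: "W K S T X" unfolding E_def by blast
      then have "W (insert k K) S T X" "W (insert k K) S T (insert k X)"
        using k that(2) unfolding W_def by blast+
      then show ?thesis using \<open>X \<subseteq> V\<close> k unfolding E_def by blast
    qed
    \<comment> \<open>If \<open>X\<close> is lost by the switch, then \<open>k\<close> is in
      \<open>T\<close>, hence not in \<open>S\<close>, and deleting \<open>k\<close> from
      \<open>X\<close> moves it to the side where \<open>T\<close> now needs it.\<close>
    have down: "X - {k} \<in> E (insert k K)"
      if "X \<in> E K" "X \<notin> E (insert k K)" "k \<in> X" for X
    proof -
      from that obtain S T where "X \<subseteq> V" and W: "W K S T X" unfolding E_def by blast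
      have "\<not> W (insert k K) S T X" using that(2) \<open>X \<subseteq> V\<close> unfolding E_def by blast
      then have "k \<in> T" using W k unfolding W_def by blast
      then have "W (insert k K) S T (X - {k})" using W k unfolding W_def by blast
      then show ?thesis using \<open>X \<subseteq> V\<close> unfolding E_def by blast
    qed
    define f where "f X = (if X \<in> E (insert k K) then X else X - {k})" for X
    have "inj_on f (E K)"
    proof (rule inj_onI)
      fix X Y assume XY: "X \<in> E K" "Y \<in> E K" "f X = f Y"
      have *: "k \<in> X" if "X \<in> E K" "X \<notin> E (insert k K)" for X
        using that up by blast
      \<comment> \<open>The only possible collision: a kept \<open>X\<close> equals a lost
        \<open>Y\<close> with \<open>k\<close> deleted. But then \<open>Y = insert k X\<close> would
        be kept by \<open>up\<close>.\<close>
      have **: "X = Y" if "X \<in> E K" "Y \<in> E K" "X \<in> E (insert k K)" "Y \<notin> E (insert k K)"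
        "X = Y - {k}" for X Y
        using up[of X] *[of Y] that by (metis Diff_iff insertI1 insert_Diff)
      show "X = Y"
      proof (cases "X \<in> E (insert k K) \<or> Y \<in> E (insert k K)")
        case True
        then show ?thesis
          using XY **[of X Y] **[of Y X] unfolding f_def by (metis (full_types))
      next
        case False
        then have "k \<in> X" "k \<in> Y" "X - {k} = Y - {k}"
          using XY * unfolding f_def by auto
        then show ?thesis by (metis insert_Diff)
      qed
    qed
    moreover have "f ` E K \<subseteq> E (insert k K)"
      using up down unfolding f_def by auto
    ultimately show ?thesis
      using card_inj_on_le fin by blast
  qed
  have "finite K \<Longrightarrow> K \<subseteq> V \<Longrightarrow> card (E {}) \<le> card (E K)" for K
  proof (induction K rule: finite_induct)
    case (insert k K)
    then show ?case using step[of k K] by (meson insert_subset order_trans)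
  qed simp
  then have "card (E {}) \<le> card (E V)"
    using V by blast
  moreover have "E {} = {X. X \<subseteq> V \<and> (\<exists>S\<in>P. \<exists>T\<in>Q. S \<inter> T = {} \<and> S \<union> T \<subseteq> X)}"
    unfolding E_def W_def by auto
  moreover have "E V \<subseteq> {X \<in> P. V - X \<in> Q}"
  proof
    fix X assume "X \<in> E V"
    then obtain S T where "X \<subseteq> V" and W: "W V S T X" unfolding E_def by blast
    then have "S \<subseteq> X" "T \<subseteq> V - X" "S \<in> P" "T \<in> Q"
      using Q(1) unfolding W_def by blast+
    then show "X \<in> {X \<in> P. V - X \<in> Q}"
      using \<open>X \<subseteq> V\<close> upset_onD[OF P(2)] upset_onD[OF Q(2)] by blast
  qed
  moreover have "finite {X \<in> P. V - X \<in> Q}"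
    using V P(1) by (simp add: finite_subset)
  ultimately show ?thesis
    by (metis card_mono order_trans)
qed

section \<open>Bounding the sum of the boxes by merging two families\<close>

text \<open>The last assumption is cross dependence. It and the up-set property both pass to the
  merged sequence, so they carry the induction, with \<open>F\<close> kept arbitrary.\<close>

lemma sum_card_box_le:
  assumes "finite I" "I \<noteq> {}" "finite V"
    and "\<And>i. i \<in> I \<Longrightarrow> F i \<subseteq> Pow V" "\<And>i. i \<in> I \<Longrightarrow> upset_on V (F i)"
    and "V \<notin> box V I F"
  shows "(\<Sum>i\<in>I. card (box V (I - {i}) F)) \<le> 2 ^ card V"
  using assms
proof (induction I arbitrary: F rule: finite_ne_induct)
  case (singleton p)
  then show ?case
    using card_mono[OF _ box_subset_Pow, of V "{}" F] by (simp add: card_Pow)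
next
  case (insert q I)
  then obtain p where p: "p \<in> I" by blast
  define J where "J = I - {p}"
  have I: "I = insert p J" and pJ: "p \<notin> J" and qp: "q \<noteq> p" and qJ: "q \<notin> J"
    using p insert.hyps unfolding J_def by auto
  have finJ: "finite J" using insert.hyps unfolding J_def by blast
  define H where "H = box V J F"
  \<comment> \<open>As \<open>H\<close> is an up-set, \<open>V - A \<notin> H\<close> says that
    \<open>A\<close> meets every member of \<open>H\<close>; so \<open>G p\<close> is the largest
    family cross dependant with those of \<open>J\<close>.\<close>
  define G where "G = F(p := {A. A \<subseteq> V \<and> V - A \<notin> H})"
  have H: "H \<subseteq> Pow V" "upset_on V H" "finite H"
    unfolding H_def by (rule box_subset_Pow upset_on_box finite_box[OF \<open>finite V\<close>])+
  have GH: "box V J G = H"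
    unfolding H_def G_def using pJ by (intro box_cong) auto
  have no: False if "S \<in> box V J F" "T \<in> F p" "U \<in> F q" "S \<inter> T = {}" "S \<inter> U = {}" "T \<inter> U = {}" for S T U
  proof -
    have sub: "S \<subseteq> V" "T \<subseteq> V" "U \<subseteq> V"
      using that(1-3) H(1) insert.prems(2)[of p] insert.prems(2)[of q] p unfolding H_def by auto
    have "S \<union> T \<in> box V I F"
      unfolding I by (rule box_insertI[of S _ _ _ T]) (use that sub in auto)
    then have "V \<in> box V (insert q I) F"
      by (rule box_insertI[of _ _ _ _ U]) (use that sub in auto)
    then show False using insert.prems by blast
  qed
  have IH: "(\<Sum>i\<in>I. card (box V (I - {i}) G)) \<le> 2 ^ card V"
  proof (rule insert.IH[OF \<open>finite V\<close>])
    show "G i \<subseteq> Pow V" if "i \<in> I" for i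
      using that insert.prems unfolding G_def by auto
    have "upset_on V (G p)"
      unfolding upset_on_def
    proof (intro ballI allI impI)
      fix A B assume "A \<in> G p" "A \<subseteq> B" "B \<subseteq> V"
      then show "B \<in> G p"
        using upset_onD[OF H(2), of "V - B" "V - A"] unfolding G_def by auto
    qed
    then show "upset_on V (G i)" if "i \<in> I" for i
      using that insert.prems by (cases "i = p") (auto simp: G_def)
    show "V \<notin> box V I G"
    proof
      assume "V \<in> box V I G"
      then obtain S T where "S \<in> H" "T \<in> G p" "S \<inter> T = {}"
        unfolding I using pJ GH by (metis box_insertE)
      moreover have "S \<subseteq> V - T" using calculation H by blast
      ultimately show False
        using upset_onD[OF H(2), of S "V - T"] by (auto simp: G_def)
    qed
  qed
  have mono: "card (box V (insert q I - {i}) F) \<le> card (box V (I - {i}) G)" if i: "i \<in> J" for i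
  proof (rule card_mono[OF finite_box[OF \<open>finite V\<close>]], rule subsetI)
    fix X assume X: "X \<in> box V (insert q I - {i}) F"
    define L where "L = J - {i}"
    have "insert q I - {i} = insert q (insert p L)"
      using i pJ qJ unfolding I L_def by blast
    then obtain S U where SU: "S \<in> box V (insert p L) F" "U \<in> F q" "S \<inter> U = {}" "S \<union> U \<subseteq> X" "X \<subseteq> V"
      using X qJ qp by (metis DiffD1 L_def box_insertE insertE)
    then obtain R T where RT: "R \<in> box V L F" "T \<in> F p" "R \<inter> T = {}" "R \<union> T \<subseteq> S"
      using pJ by (metis DiffD1 L_def box_insertE)
    \<comment> \<open>The union of disjoint members of \<open>F p\<close> and \<open>F q\<close>
      belongs to the merged family, so every witness for \<open>F\<close> yields one for
      \<open>G\<close>.\<close>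
    have "V - (T \<union> U) \<notin> H"
    proof
      assume "V - (T \<union> U) \<in> H"
      then show False
        using no[of "V - (T \<union> U)" T U] SU RT unfolding H_def by blast
    qed
    then have "T \<union> U \<in> G p"
      using SU RT unfolding G_def by auto
    moreover have "R \<in> box V L G"
    proof -
      have "box V L F = box V L G"
        using pJ by (intro box_cong) (auto simp: G_def L_def)
      then show ?thesis using RT(1) by simp
    qed
    ultimately have "X \<in> box V (insert p L) G"
      using SU RT by (intro box_insertI[of R _ _ _ "T \<union> U"]) auto
    also have "insert p L = I - {i}"
      using i pJ unfolding I L_def by blast
    finally show "X \<in> box V (I - {i}) G" .
  qed
  \<comment> \<open>Correlation replaces the first box by the sets of \<open>H\<close> whose
    complement is in \<open>F q\<close>. Such a set is not in the second box, or \<open>no\<close>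
    would be violated, and both collections lie in \<open>H\<close>.\<close>
  have "card (box V (insert q J) F) + card (box V (insert p J) F) \<le> card H"
  proof -
    have "box V (insert q J) F \<subseteq> {X. X \<subseteq> V \<and> (\<exists>S\<in>H. \<exists>T\<in>F q. S \<inter> T = {} \<and> S \<union> T \<subseteq> X)}"
      unfolding H_def using qJ by (auto elim!: box_insertE)
    then have "card (box V (insert q J) F)
        \<le> card {X. X \<subseteq> V \<and> (\<exists>S\<in>H. \<exists>T\<in>F q. S \<inter> T = {} \<and> S \<union> T \<subseteq> X)}"
      using \<open>finite V\<close> by (intro card_mono) auto
    also have "\<dots> \<le> card {X \<in> H. V - X \<in> F q}"
      using insert.prems H by (intro card_disjoint_occurrence_le) auto
    finally have "card (box V (insert q J) F) + card (box V (insert p J) F)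
        \<le> card {X \<in> H. V - X \<in> F q} + card (box V (insert p J) F)" by simp
    also have "\<dots> = card ({X \<in> H. V - X \<in> F q} \<union> box V (insert p J) F)"
    proof (rule card_Un_disjoint[symmetric])
      show "{X \<in> H. V - X \<in> F q} \<inter> box V (insert p J) F = {}"
      proof safe
        fix X assume "V - X \<in> F q" "X \<in> box V (insert p J) F"
        then show "X \<in> {}"
          using no[of _ _ "V - X"] pJ by (elim box_insertE) blast+
      qed
    qed (use H finite_box[OF \<open>finite V\<close>] in auto)
    also have "\<dots> \<le> card H"
      using H box_antimono[of J "insert p J" V F] by (intro card_mono) (auto simp: H_def)
    finally show ?thesis .
  qed
  \<comment> \<open>Omitting the merged family \<open>p\<close> leaves exactly \<open>J\<close>,
    where \<open>G\<close> agrees with \<open>F\<close>; this summand is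
    \<open>card H\<close>.\<close>
  moreover have "(\<Sum>i\<in>I. card (box V (I - {i}) G)) = card H + (\<Sum>i\<in>J. card (box V (I - {i}) G))"
    using finJ pJ GH unfolding I by (simp add: insert_Diff_if)
  moreover have "(\<Sum>i\<in>J. card (box V (insert q I - {i}) F)) \<le> (\<Sum>i\<in>J. card (box V (I - {i}) G))"
    by (rule sum_mono[OF mono])
  moreover have "(\<Sum>i\<in>insert q I. card (box V (insert q I - {i}) F)) =
      card (box V (insert p J) F) + (card (box V (insert q J) F)
        + (\<Sum>i\<in>J. card (box V (insert q I - {i}) F)))"
  proof -
    have *: "insert q I - {q} = insert p J" "insert q I - {p} = insert q J"
      using qp qJ pJ unfolding I by blast+
    have "sum f (insert q I) = f q + (f p + sum f J)" for f :: "_ \<Rightarrow> nat"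
      using qp qJ pJ finJ by (simp add: I)
    from this[of "\<lambda>i. card (box V (insert q I - {i}) F)"] show ?thesis
      unfolding * .
  qed
  ultimately show ?case using IH by linarith
qed

section \<open>From saturation to boxes\<close>

theorem theorem1p5:
  fixes s n :: nat and F :: "nat \<Rightarrow> nat set set"
  assumes "s \<ge> 2" and "n \<ge> 1"
    and "\<forall>i\<in>{1..s}. F i \<subseteq> Pow {1..n}"
    and "cross_saturated n s F"
  shows "(\<Sum>i=1..s. card (F i)) \<ge> (s - 1) * 2 ^ n"
proof -
  let ?V = "{1..n}" and ?I = "{1..s}"
  have dep: "\<not> ((\<forall>i\<in>?I. A i \<in> F i) \<and> disjoint_family_on A ?I)" for A
    using assms(4) unfolding cross_saturated_def cross_dependant_def by blast
  \<comment> \<open>The disjoint choice made possible by adding \<open>X\<close> must use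
    \<open>X\<close> at \<open>i\<close>, since \<open>F\<close> itself admits none.\<close>
  have sat: "\<exists>A. A i = X \<and> (\<forall>j\<in>?I - {i}. A j \<in> F j) \<and> disjoint_family_on A ?I"
    if i: "i \<in> ?I" and X: "X \<subseteq> ?V" "X \<notin> F i" for i X
  proof -
    have "\<not> cross_dependant s (F(i := F i \<union> {X}))"
      using assms(4) i X unfolding cross_saturated_def by blast
    then obtain A where A: "\<And>j. j \<in> ?I \<Longrightarrow> A j \<in> (F(i := F i \<union> {X})) j" "disjoint_family_on A ?I"
      unfolding cross_dependant_def by blast
    have oth: "\<forall>j\<in>?I - {i}. A j \<in> F j"
      using A(1) by (metis Diff_iff fun_upd_other singletonI)
    then have "A i \<notin> F i" using dep[of A] A(2) by blast
    then have "A i = X" using A(1)[OF i] by simp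
    then show ?thesis using oth A(2) by blast
  qed
  \<comment> \<open>Were \<open>B\<close> missing, a disjoint choice would use it at
    \<open>i\<close>; shrinking \<open>B\<close> to \<open>A\<close> keeps disjointness and
    contradicts \<open>dep\<close>.\<close>
  have up: "upset_on ?V (F i)" if i: "i \<in> ?I" for i
    unfolding upset_on_def
  proof (intro ballI allI impI, rule ccontr)
    fix A B assume AB: "A \<in> F i" "A \<subseteq> B" "B \<subseteq> ?V" "B \<notin> F i"
    then obtain C where C: "C i = B" "\<forall>j\<in>?I - {i}. C j \<in> F j" "disjoint_family_on C ?I"
      using sat[OF i] by blast
    have "C j \<inter> A = {}" if "j \<in> ?I" "j \<noteq> i" for j
      using disjoint_family_onD[OF C(3) that(1) i that(2)] C(1) AB(2) by blast
    then have "disjoint_family_on (C(i := A)) ?I"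
      using disjoint_family_on_fun_upd[OF C(3), of i A] i by (simp add: insert_absorb)
    moreover have "\<forall>j\<in>?I. (C(i := A)) j \<in> F j" using C AB by auto
    ultimately show False using dep by blast
  qed
  \<comment> \<open>By \<open>sat\<close>, the complement of each set missing from
    \<open>F i\<close> contains disjoint members of all the other families, so complementation
    bounds the number of missing sets by the box.\<close>
  have large: "2 ^ n \<le> card (F i) + card (box ?V (?I - {i}) F)" if i: "i \<in> ?I" for i
  proof -
    have "Pow ?V - F i \<subseteq> (\<lambda>X. ?V - X) ` box ?V (?I - {i}) F"
    proof
      fix X assume X: "X \<in> Pow ?V - F i"
      then obtain A where A: "A i = X" "\<forall>j\<in>?I - {i}. A j \<in> F j" "disjoint_family_on A ?I"
        using sat[OF i] by blast
      have "?V - X \<in> box ?V (?I - {i}) F"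
      proof (rule boxI[where A = A])
        show "A j \<subseteq> ?V - X" if "j \<in> ?I - {i}" for j
        proof -
          have "A j \<subseteq> ?V" using A(2) assms(3) that by blast
          moreover have "A j \<inter> A i = {}" using A(3) that i unfolding disjoint_family_on_def by blast
          ultimately show ?thesis using A(1) by blast
        qed
        show "disjoint_family_on A (?I - {i})"
          using A(3) unfolding disjoint_family_on_def by blast
      qed (use A in auto)
      moreover have "X = ?V - (?V - X)" using X by blast
      ultimately show "X \<in> (\<lambda>X. ?V - X) ` box ?V (?I - {i}) F" by blast
    qed
    then have "card (Pow ?V - F i) \<le> card (box ?V (?I - {i}) F)"
      by (rule surj_card_le[OF finite_box, rotated]) simp
    moreover have "card (Pow ?V) \<le> card (F i) + card (Pow ?V - F i)"
      using card_Un_le[of "F i" "Pow ?V - F i"] assms(3) i by (simp add: Un_absorb1)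
    ultimately show ?thesis by (simp add: card_Pow)
  qed
  have "(\<Sum>i\<in>?I. card (box ?V (?I - {i}) F)) \<le> 2 ^ card ?V"
  proof (rule sum_card_box_le)
    show "?V \<notin> box ?V ?I F"
      using dep by (auto elim!: boxE)
  qed (use assms up in auto)
  \<comment> \<open>Summing \<open>large\<close> gives \<open>s * 2 ^ n\<close> on the left; the
    boxes account for at most one \<open>2 ^ n\<close> of it.\<close>
  moreover have "(\<Sum>i\<in>?I. 2 ^ n) \<le> (\<Sum>i\<in>?I. card (F i) + card (box ?V (?I - {i}) F))"
    by (rule sum_mono[OF large])
  ultimately show ?thesis
    by (simp add: sum.distrib diff_mult_distrib)
qed

end
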